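(* If $G$ is a pendant-free graph on $n$ vertices that is not isomorphic to $K_4$ or $K_4^-$, then $\gamma^{\mathrm{EID}}(G)\leq 2n-5$.
   Context: Graphs are simple, with nonempty edge set. $K_4$ is the complete graph on $4$ vertices and $K_4^-$ is the graph obtained from $K_4$ by removing one edge. For an edge $e$ of a graph $G$, $N[e]$ denotes the set consisting of $e$ and all edges of $G$ adjacent to $e$ (i.e. sharing an endpoint with $e$). A subset $\mathcal{C}_E\subseteq E(G)$ is an edge-identifying code of $G$ if $N[e]\cap\mathcal{C}_E\neq\emptyset$ for every $e\in E(G)$, and $N[e]\cap\mathcal{C}_E\neq N[f]\cap\mathcal{C}_E$ for all distinct $e,f\in E(G)$. A pair of adjacent edges $ux,uy$ ($x\neq y$) of $G$ is pendant if either both $x$ and $y$ have degree $1$ in $G$, or both $x$ and $y$ have degree $2$ in $G$ and $xy\in E(G)$; $G$ is pendant-free if it has no pendant pair of edges (equivalently, $G$ admits an edge-identifying code). For a pendant-free graph $G$, $\gamma^{\mathrm{EID}}(G)$ is the minimum size of an edge-identifying code of $G$.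
   Formalization: The graph G is additionally assumed not to be isomorphic to K_2: K_2 is pendant-free with γ^EID = 1, while 2n−5 = −1, so the claim as stated fails for exactly this graph. *)

theory Defs
  imports Main "HOL-Library.Ramsey"
begin

text \<open>An edge is the two-element set of its endpoints; \<open>[V]\<^bsup>2\<^esup>\<close>, the set of all two-element
  subsets of \<open>V\<close>, is thus the edge set of the complete graph on \<open>V\<close>.\<close>

definition simple_graph :: "'a set \<Rightarrow> 'a set set \<Rightarrow> bool" where
  "simple_graph V E \<longleftrightarrow> finite V \<and> E \<subseteq> [V]\<^bsup>2\<^esup> \<and> E \<noteq> {}"

definition graph_iso :: "'a set \<Rightarrow> 'a set set \<Rightarrow> 'b set \<Rightarrow> 'b set set \<Rightarrow> bool" where
  "graph_iso V E V' E' \<longleftrightarrow>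
    (\<exists>\<phi>. bij_betw \<phi> V V' \<and> (\<forall>x\<in>V. \<forall>y\<in>V. {x, y} \<in> E \<longleftrightarrow> {\<phi> x, \<phi> y} \<in> E'))"

text \<open>Instances with \<open>m = 4\<close> and \<open>m = 2\<close> are needed: besides \<open>K\<^sub>4\<close>, the graph \<open>K\<^sub>2\<close> violates the bound
  \<open>2 n - 5\<close>, since it is pendant-free and its only edge is a code of size \<open>1 > -1\<close>.\<close>

definition is_complete :: "nat \<Rightarrow> 'a set \<Rightarrow> 'a set set \<Rightarrow> bool" where
  "is_complete m V E \<longleftrightarrow> graph_iso V E {..<m} ([{..<m}]\<^bsup>2\<^esup>)"

definition is_K4_minus :: "'a set \<Rightarrow> 'a set set \<Rightarrow> bool" where
  "is_K4_minus V E \<longleftrightarrow> graph_iso V E {..<4::nat} ([{..<4}]\<^bsup>2\<^esup> - {{0, 1}})"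

definition degree :: "'a set set \<Rightarrow> 'a \<Rightarrow> nat" where
  "degree E v = card {e \<in> E. v \<in> e}"

definition closed_edge_nbhd :: "'a set set \<Rightarrow> 'a set \<Rightarrow> 'a set set" where
  "closed_edge_nbhd E e = insert e {f \<in> E. f \<noteq> e \<and> e \<inter> f \<noteq> {}}"

definition edge_id_code :: "'a set set \<Rightarrow> 'a set set \<Rightarrow> bool" where
  "edge_id_code E C \<longleftrightarrow> C \<subseteq> E \<and>
    (\<forall>e\<in>E. closed_edge_nbhd E e \<inter> C \<noteq> {}) \<and>
    (\<forall>e\<in>E. \<forall>f\<in>E. e \<noteq> f \<longrightarrow> closed_edge_nbhd E e \<inter> C \<noteq> closed_edge_nbhd E f \<inter> C)"

definition pendant_pair :: "'a set set \<Rightarrow> 'a set \<Rightarrow> 'a set \<Rightarrow> bool" where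
  "pendant_pair E e f \<longleftrightarrow> e \<in> E \<and> f \<in> E \<and>
    (\<exists>u x y. e = {u, x} \<and> f = {u, y} \<and> x \<noteq> y \<and>
      (degree E x = 1 \<and> degree E y = 1 \<or>
       degree E x = 2 \<and> degree E y = 2 \<and> {x, y} \<in> E))"

definition pendant_free :: "'a set set \<Rightarrow> bool" where
  "pendant_free E \<longleftrightarrow> (\<nexists>e f. pendant_pair E e f)"

text \<open>Meaningful only for pendant-free graphs: without a code the value is unspecified.\<close>

definition gamma_EID :: "'a set set \<Rightarrow> nat" where
  "gamma_EID E = (LEAST k. \<exists>C. edge_id_code E C \<and> card C = k)"

end

theory Submission
  imports Defs
begin

text \<open>
  Take a code \<open>C\<close> of minimum size, let \<open>n\<close> be the number of vertices, and let degrees and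
  neighbours refer to the graph formed by the edges of \<open>C\<close>. Codes exist because two edges with the
  same closed neighbourhood form a pendant pair, so that the set of all edges is a code
  (\<open>pendant_free_imp_code\<close>).

  Minimality is used through \<open>witness\<close>: if both ends of a code edge \<open>c\<close> lie on further code edges,
  then deleting \<open>c\<close> can only make two edges \<open>e\<close> and \<open>f\<close> indistinguishable, that is, \<open>e\<close> meets \<open>c\<close>,
  \<open>f\<close> does not, and both meet the same other code edges. If moreover both ends of \<open>c\<close> have degree at
  least 3 (call \<open>c\<close> heavy) and \<open>u\<close> is an end of \<open>c\<close> on \<open>e\<close>, then \<open>f\<close> contains all neighbours
  of \<open>u\<close> outside \<open>c\<close>. So there are exactly two of them, and the edges meeting \<open>f\<close> have to meet \<open>e\<close>,
  which leaves one of these two neighbours with degree at most 2 (\<open>heavy_edge_tail\<close>). Hence no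
  nonempty vertex set induces minimum degree 3 in \<open>C\<close>, and every set \<open>W\<close> of at least two vertices
  spans at most \<open>2 |W| - 3\<close> code edges (\<open>card_inside_le\<close>).

  This yields \<open>2 n - 3\<close>. To gain 2 more for \<open>n \<ge> 5\<close>, suppose \<open>|C| \<ge> 2 n - 4\<close>. The bound for the
  complement of a small vertex set \<open>T\<close> now shows that \<open>T\<close> touches at least \<open>2 |T| - 1\<close> code edges
  (\<open>touched_ge\<close>). The configuration around a heavy edge is so sparse that this leaves only one
  possibility: all heavy edges share an end \<open>u\<close> of degree 3 that has a neighbour of degree 1. There
  are then at most 2 heavy edges and at least 3 vertices of degree at least 3. Every other code edge
  has a light end, i.e. an end of degree at most 2, so summing degrees over the light vertices gives
  \<open>|C| \<le> 2 + (2 (n - 3) - 1) = 2 n - 5\<close>, a contradiction (\<open>no_heavy_edge\<close>). Without heavy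
  edges, the same count allows at most two vertices that are not light, and it leaves only two
  extremal graphs: the complete bipartite graph with parts of sizes 2 and \<open>n - 2\<close>, and, for \<open>n = 5\<close>,
  two triangles sharing a vertex. In both, \<open>witness\<close> fails (\<open>card_heavy_neq_2\<close>,
  \<open>no_dominating_vertex\<close>).

  For \<open>n = 4\<close>, exceeding the bound 3 means having at least 4 edges. With the complete graph and the
  complete graph minus an edge excluded, the missing edges are two: if they are adjacent there is a
  pendant pair, otherwise the graph is a 4-cycle, which has a code of size 3. For \<open>n = 3\<close> any two
  edges have the same closed neighbourhood, so there is only one edge.
\<close>

section \<open>Edges and codes\<close>

lemma edge_obtain:
  assumes "e \<in> [V]\<^bsup>2\<^esup>"
  obtains x y where "e = {x, y}" "x \<noteq> y" "x \<in> V" "y \<in> V"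
  using assms by (auto simp: nsets_def card_2_iff)

lemma edge_obtain_at:
  assumes "e \<in> [V]\<^bsup>2\<^esup>" "u \<in> e"
  obtains w where "e = {u, w}" "w \<noteq> u" "w \<in> V"
  using assms by (auto simp: nsets_def card_2_iff)

lemma closed_edge_nbhd_Int:
  assumes "E \<subseteq> [V]\<^bsup>2\<^esup>" "e \<in> E" "C \<subseteq> E"
  shows "closed_edge_nbhd E e \<inter> C = {c \<in> C. c \<inter> e \<noteq> {}}"
proof -
  have "e \<noteq> {}" using assms by (auto simp: nsets_def)
  thus ?thesis using assms by (auto simp: closed_edge_nbhd_def)
qed

text \<open>Members of \<open>N[e]\<close> are just the edges meeting \<open>e\<close>, so codes are a matter of intersections only.\<close>

lemma edge_id_code_iff:
  assumes "E \<subseteq> [V]\<^bsup>2\<^esup>" "C \<subseteq> E"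
  shows "edge_id_code E C \<longleftrightarrow>
    (\<forall>e\<in>E. \<exists>c\<in>C. c \<inter> e \<noteq> {}) \<and>
    (\<forall>e\<in>E. \<forall>f\<in>E. e \<noteq> f \<longrightarrow> (\<exists>c\<in>C. (c \<inter> e \<noteq> {}) \<noteq> (c \<inter> f \<noteq> {})))"
proof -
  have nbhd: "closed_edge_nbhd E e \<inter> C = {c \<in> C. c \<inter> e \<noteq> {}}" if "e \<in> E" for e
    by (rule closed_edge_nbhd_Int[OF assms(1) that assms(2)])
  have neq: "{c \<in> C. P c} \<noteq> {c \<in> C. Q c} \<longleftrightarrow> (\<exists>c\<in>C. P c \<noteq> Q c)" for P Q
    by auto
  have dom: "closed_edge_nbhd E e \<inter> C \<noteq> {} \<longleftrightarrow> (\<exists>c\<in>C. c \<inter> e \<noteq> {})" if "e \<in> E" for e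
    by (simp only: nbhd[OF that] Collect_empty_eq Bex_def not_all not_not)
  have sep: "closed_edge_nbhd E e \<inter> C \<noteq> closed_edge_nbhd E f \<inter> C \<longleftrightarrow>
      (\<exists>c\<in>C. (c \<inter> e \<noteq> {}) \<noteq> (c \<inter> f \<noteq> {}))" if "e \<in> E" "f \<in> E" for e f
    unfolding nbhd[OF that(1)] nbhd[OF that(2)] by (rule neq)
  show ?thesis
    unfolding edge_id_code_def using assms(2) by (simp add: dom sep cong: ball_cong)
qed

text \<open>Edges \<open>ux\<close> and \<open>uy\<close> with the same closed neighbourhood admit no further edge at \<open>x\<close> or \<open>y\<close>
  except \<open>xy\<close>; the two alternatives of a pendant pair correspond to the presence of \<open>xy\<close>.\<close>

lemma pendant_free_imp_code:
  assumes EV: "E \<subseteq> [V]\<^bsup>2\<^esup>" and pf: "pendant_free E"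
  shows "edge_id_code E E"
  unfolding edge_id_code_iff[OF EV order_refl]
proof (intro conjI ballI impI)
  fix e assume "e \<in> E"
  moreover have "e \<inter> e \<noteq> {}" using \<open>e \<in> E\<close> EV by (auto simp: nsets_def)
  ultimately show "\<exists>c\<in>E. c \<inter> e \<noteq> {}" by (rule bexI[rotated])
next
  fix e f assume e: "e \<in> E" and f: "f \<in> E" and "e \<noteq> f"
  show "\<exists>c\<in>E. (c \<inter> e \<noteq> {}) \<noteq> (c \<inter> f \<noteq> {})"
  proof (rule ccontr)
    assume "\<not> ?thesis"
    hence twin: "c \<inter> e \<noteq> {} \<longleftrightarrow> c \<inter> f \<noteq> {}" if "c \<in> E" for c
      using that by (auto 0 0 simp only: bex_simps ball_simps not_not)
    have "e \<inter> e \<noteq> {}" using e EV by (auto simp: nsets_def)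
    hence "e \<inter> f \<noteq> {}" using twin[OF e] by simp
    then obtain u where u: "u \<in> e" "u \<in> f" by auto
    obtain x where x: "e = {u, x}" "x \<noteq> u" by (rule edge_obtain_at[OF subsetD[OF EV e] u(1)])
    obtain y where y: "f = {u, y}" "y \<noteq> u" by (rule edge_obtain_at[OF subsetD[OF EV f] u(2)])
    have "x \<noteq> y" using \<open>e \<noteq> f\<close> x y by auto
    have atx: "c = e \<or> c = {x, y}" if cE: "c \<in> E" and xc: "x \<in> c" for c
    proof -
      obtain z where z: "c = {x, z}" by (rule edge_obtain_at[OF subsetD[OF EV cE] xc])
      thus ?thesis using twin[OF \<open>c \<in> E\<close>] x y \<open>x \<noteq> y\<close> by (auto simp: doubleton_eq_iff)
    qed
    have aty: "c = f \<or> c = {x, y}" if cE: "c \<in> E" and xc: "y \<in> c" for c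
    proof -
      obtain z where z: "c = {y, z}" by (rule edge_obtain_at[OF subsetD[OF EV cE] xc])
      thus ?thesis using twin[OF \<open>c \<in> E\<close>] x y \<open>x \<noteq> y\<close> by (auto simp: doubleton_eq_iff)
    qed
    have "pendant_pair E e f"
    proof (cases "{x, y} \<in> E")
      case True
      have "{c \<in> E. x \<in> c} = {e, {x, y}}" "{c \<in> E. y \<in> c} = {f, {x, y}}"
        using atx aty True e f x y by auto
      moreover have "e \<noteq> {x, y}" "f \<noteq> {x, y}"
        using x y \<open>x \<noteq> y\<close> by (auto simp: doubleton_eq_iff)
      ultimately have "degree E x = 2" "degree E y = 2" by (auto simp: degree_def)
      thus ?thesis using e f x y \<open>x \<noteq> y\<close> True unfolding pendant_pair_def by blast
    next
      case False
      have "{c \<in> E. x \<in> c} = {e}" "{c \<in> E. y \<in> c} = {f}"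
        using atx aty False e f x y by auto
      hence "degree E x = 1" "degree E y = 1" by (auto simp: degree_def)
      thus ?thesis using e f x y \<open>x \<noteq> y\<close> unfolding pendant_pair_def by blast
    qed
    thus False using pf by (auto simp: pendant_free_def)
  qed
qed

section \<open>Local consequences of irredundancy\<close>

locale irredundant_code =
  fixes V :: "'a set" and E C :: "'a set set"
  assumes finite_V: "finite V"
    and E_sub: "E \<subseteq> [V]\<^bsup>2\<^esup>"
    and code: "edge_id_code E C"
    and irredundant: "\<And>c. c \<in> C \<Longrightarrow> \<not> edge_id_code E (C - {c})"
begin

definition nb :: "'a \<Rightarrow> 'a set" where
  "nb v = {w. {v, w} \<in> C}"

lemma C_sub: "C \<subseteq> E"
  using code by (simp add: edge_id_code_def)

lemma C_obtain:
  assumes "c \<in> C"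
  obtains x y where "c = {x, y}" "x \<noteq> y" "x \<in> V" "y \<in> V"
  using edge_obtain assms C_sub E_sub by blast

lemma dominated: "e \<in> E \<Longrightarrow> \<exists>c\<in>C. c \<inter> e \<noteq> {}"
  using code[unfolded edge_id_code_iff[OF E_sub C_sub]] by (elim conjE bspec)

lemma separated:
  "e \<in> E \<Longrightarrow> f \<in> E \<Longrightarrow> e \<noteq> f \<Longrightarrow> \<exists>c\<in>C. (c \<inter> e \<noteq> {}) \<noteq> (c \<inter> f \<noteq> {})"
  by (rule code[unfolded edge_id_code_iff[OF E_sub C_sub], THEN conjunct2, rule_format])

lemma finite_C: "finite C"
proof -
  have "C \<subseteq> Pow V" using C_sub E_sub by (auto simp: nsets_def)
  thus ?thesis using finite_V by (simp add: finite_subset)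
qed

lemma nb_sym: "w \<in> nb v \<longleftrightarrow> v \<in> nb w"
  by (simp add: nb_def insert_commute)

lemma nb_edge: "w \<in> nb v \<Longrightarrow> {v, w} \<in> C"
  by (simp add: nb_def)

lemma C_obtain_at:
  assumes "c \<in> C" "u \<in> c"
  obtains w where "c = {u, w}" "w \<in> nb u"
proof -
  obtain w where "c = {u, w}"
    by (rule edge_obtain_at[OF subsetD[OF E_sub subsetD[OF C_sub assms(1)]] assms(2)])
  thus ?thesis using that assms(1) by (simp add: nb_def)
qed

lemma nb_irrefl: "v \<notin> nb v"
proof
  assume "v \<in> nb v"
  hence "{v} \<in> [V]\<^bsup>2\<^esup>" using C_sub E_sub by (auto simp: nb_def)
  thus False by (simp add: nsets_def)
qed

lemma nb_in_V:
  assumes "w \<in> nb v" shows "w \<in> V" "v \<in> V"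
proof -
  have "{v, w} \<in> [V]\<^bsup>2\<^esup>" using assms C_sub E_sub unfolding nb_def by blast
  thus "w \<in> V" "v \<in> V" unfolding nsets_def by blast+
qed

lemma finite_nb: "finite (nb v)"
proof -
  have "nb v \<subseteq> V" using nb_in_V by blast
  thus ?thesis using finite_V finite_subset by blast
qed

lemma ex_other_nb:
  assumes "card (nb u) \<ge> 2" obtains p where "p \<in> nb u" "p \<noteq> v"
proof -
  have "\<not> nb u \<subseteq> {v}"
  proof
    assume "nb u \<subseteq> {v}"
    hence "card (nb u) \<le> 1" using card_mono[of "{v}" "nb u"] by simp
    thus False using assms by simp
  qed
  thus ?thesis using that by blast
qed

text \<open>The degree assumptions exclude that deleting \<open>uv\<close> leaves an edge undominated, because an edge
  through \<open>u\<close> or \<open>v\<close> still meets another code edge there.\<close>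

lemma witness:
  assumes uv: "v \<in> nb u" and du: "card (nb u) \<ge> 2" and dv: "card (nb v) \<ge> 2"
  obtains e f where "e \<in> E" "f \<in> E" "e \<noteq> f" "u \<in> e \<or> v \<in> e" "u \<notin> f" "v \<notin> f"
    "\<And>p q. q \<in> nb p \<Longrightarrow> {p, q} \<noteq> {u, v} \<Longrightarrow> (p \<in> e \<or> q \<in> e) \<longleftrightarrow> (p \<in> f \<or> q \<in> f)"
proof -
  let ?c = "{u, v}"
  have c: "?c \<in> C" using uv by (simp add: nb_def)
  have "C - {?c} \<subseteq> E" using C_sub by auto
  from irredundant[OF c] consider
      (dom) e where "e \<in> E" "\<forall>c\<in>C - {?c}. c \<inter> e = {}"
    | (sep) e f where "e \<in> E" "f \<in> E" "e \<noteq> f"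
        "\<forall>c\<in>C - {?c}. (c \<inter> e \<noteq> {}) = (c \<inter> f \<noteq> {})"
    unfolding edge_id_code_iff[OF E_sub \<open>C - {?c} \<subseteq> E\<close>] by auto
  thus ?thesis
  proof cases
    case dom
    obtain d where "d \<in> C" "d \<inter> e \<noteq> {}"
      using dominated[OF dom(1)] by (elim bexE)
    hence "d = ?c" using dom(2) by blast
    hence "u \<in> e \<or> v \<in> e" using \<open>d \<inter> e \<noteq> {}\<close> by blast
    moreover have False if we: "w \<in> e" and w: "w \<in> nb w'" "card (nb w) \<ge> 2" "?c = {w', w}" for w w'
    proof -
      obtain p where p: "p \<in> nb w" "p \<noteq> w'" using ex_other_nb w(2) by blast
      hence "{w, p} \<in> C - {?c}" using w nb_edge by (auto simp: doubleton_eq_iff)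
      hence "{w, p} \<inter> e = {}" by (rule bspec[OF dom(2)])
      thus False using we by simp
    qed
    moreover have "u \<in> nb v" "?c = {v, u}" using uv nb_sym by auto
    ultimately have False using uv du dv by blast
    thus ?thesis ..
  next
    case sep
    obtain d where d: "d \<in> C" "(d \<inter> e \<noteq> {}) \<noteq> (d \<inter> f \<noteq> {})"
      using separated[OF sep(1-3)] by (elim bexE)
    have "d = ?c"
    proof (rule ccontr)
      assume "d \<noteq> ?c"
      hence "d \<in> C - {?c}" using d(1) by simp
      thus False using bspec[OF sep(4)] d(2) by simp
    qed
    have *: "(p \<in> e \<or> q \<in> e) \<longleftrightarrow> (p \<in> f \<or> q \<in> f)" if "q \<in> nb p" "{p, q} \<noteq> {u, v}" for p q
    proof -
      have "{p, q} \<in> C - {?c}" using that nb_edge by auto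
      hence "({p, q} \<inter> e \<noteq> {}) = ({p, q} \<inter> f \<noteq> {})" by (rule bspec[OF sep(4)])
      thus ?thesis by auto
    qed
    show ?thesis
    proof (cases "?c \<inter> f = {}")
      case True
      hence "?c \<inter> e \<noteq> {}" using d \<open>d = ?c\<close> by auto
      thus ?thesis using that[of e f] sep True * by auto
    next
      case False
      hence "?c \<inter> e = {}" using d \<open>d = ?c\<close> by auto
      thus ?thesis using that[of f e] sep False * by auto
    qed
  qed
qed

text \<open>
  The two possible surroundings of a heavy edge \<open>uv\<close> that is witnessed by an edge \<open>e = uw\<close> through
  \<open>u\<close> and the edge \<open>f = xy\<close>: either \<open>w\<close> is one of \<open>x\<close> and \<open>y\<close> (named \<open>x\<close> here), or \<open>w\<close> is a further
  vertex, possibly \<open>v\<close> itself. In both cases \<open>y\<close> has degree at most 2.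
\<close>

definition tail :: "'a \<Rightarrow> 'a \<Rightarrow> bool" where
  "tail u v \<longleftrightarrow> (\<exists>x y. nb u = {v, x, y} \<and> distinct [v, x, y] \<and>
     (nb y \<subseteq> {u, x} \<or>
      (\<exists>w\<in>V. w \<notin> {u, x, y} \<and> nb x \<subseteq> {u, w} \<and> nb y \<subseteq> {u, w} \<and> nb w \<subseteq> {u, x, y})))"

text \<open>As \<open>f\<close> avoids \<open>u\<close> but meets every code edge at \<open>u\<close> other than \<open>uv\<close>, it consists of the
  neighbours of \<open>u\<close> other than \<open>v\<close>. All code edges meeting \<open>f\<close> have to meet \<open>e\<close>, and all those
  meeting \<open>e\<close>, apart from \<open>uv\<close>, have to meet \<open>f\<close>; this confines the neighbours of \<open>x\<close>, \<open>y\<close> and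
  \<open>w\<close>.\<close>

lemma tail_if_witness_at:
  assumes uv: "v \<in> nb u" and du: "card (nb u) \<ge> 3"
    and e: "e \<in> E" "u \<in> e" and f: "f \<in> E" "u \<notin> f" "v \<notin> f"
    and same: "\<And>p q. q \<in> nb p \<Longrightarrow> {p, q} \<noteq> {u, v} \<Longrightarrow> (p \<in> e \<or> q \<in> e) \<longleftrightarrow> (p \<in> f \<or> q \<in> f)"
  shows "tail u v"
proof -
  obtain w where w: "e = {u, w}" "w \<noteq> u" "w \<in> V" 
    by (rule edge_obtain_at[OF subsetD[OF E_sub e(1)] e(2)])
  obtain x y where xy: "f = {x, y}" "x \<noteq> y" 
    by (rule edge_obtain[OF subsetD[OF E_sub f(1)]])
  have "nb u - {v} \<subseteq> f"
  proof
    fix p assume p: "p \<in> nb u - {v}"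
    hence "{u, p} \<noteq> {u, v}" by (auto simp: doubleton_eq_iff)
    thus "p \<in> f" using same[of p u] p e f by auto
  qed
  moreover have "card (nb u - {v}) \<ge> 2" using du uv by simp
  ultimately have "nb u - {v} = f" using xy by (intro card_seteq) auto
  hence nbu: "nb u = {v, x, y}" using uv xy by auto
  have dist: "distinct [v, x, y]" "x \<noteq> u" "y \<noteq> u" using xy f by auto
  have at_f: "nb p \<subseteq> {u, w}" if "p \<in> f" "p \<notin> e" for p
  proof
    fix q assume "q \<in> nb p"
    moreover have "{p, q} \<noteq> {u, v}" using that f by (auto simp: doubleton_eq_iff)
    ultimately show "q \<in> {u, w}" using same[of q p] that w by blast
  qed
  have at_w: "nb w \<subseteq> {u, x, y}" if "w \<notin> f"
  proof
    fix q assume q: "q \<in> nb w"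
    show "q \<in> {u, x, y}"
    proof (cases "q = u")
      case False
      hence "{w, q} \<noteq> {u, v}" using w by (auto simp: doubleton_eq_iff)
      thus ?thesis using same[OF q] that w xy by blast
    qed simp
  qed
  have px: "nb x \<subseteq> {u, w}" if "w \<noteq> x" using at_f[of x] that w xy dist by blast
  have py: "nb y \<subseteq> {u, w}" if "w \<noteq> y" using at_f[of y] that w xy dist by blast
  consider "w = x" | "w = y" | "w \<notin> f" using xy by blast
  thus ?thesis
  proof cases
    case 1
    hence "nb y \<subseteq> {u, x}" using py xy(2) by blast
    thus ?thesis unfolding tail_def using nbu dist(1) by (intro exI[of _ x] exI[of _ y] conjI disjI1)
  next
    case 2
    have "nb u = {v, y, x}" "distinct [v, y, x]" "nb x \<subseteq> {u, y}"
      using nbu dist px[unfolded 2] xy(2) by auto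
    thus ?thesis unfolding tail_def by (intro exI[of _ y] exI[of _ x] conjI disjI1)
  next
    case 3
    hence "w \<noteq> x" "w \<noteq> y" using xy by auto
    hence "w \<notin> {u, x, y}" "nb x \<subseteq> {u, w}" "nb y \<subseteq> {u, w}" "nb w \<subseteq> {u, x, y}"
      using px py at_w[OF 3] w by auto
    thus ?thesis unfolding tail_def using nbu dist(1) w(3)
      by (intro exI[of _ x] exI[of _ y] conjI disjI2 bexI[of _ w])
  qed
qed

lemma heavy_edge_tail:
  assumes uv: "v \<in> nb u" and du: "card (nb u) \<ge> 3" and dv: "card (nb v) \<ge> 3"
  shows "tail u v \<or> tail v u"
proof -
  obtain e f where ef: "e \<in> E" "f \<in> E" "u \<in> e \<or> v \<in> e" "u \<notin> f" "v \<notin> f"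
    "\<And>p q. q \<in> nb p \<Longrightarrow> {p, q} \<noteq> {u, v} \<Longrightarrow> (p \<in> e \<or> q \<in> e) \<longleftrightarrow> (p \<in> f \<or> q \<in> f)"
    by (rule witness[OF uv]) (use du dv in auto)
  have "u \<in> nb v" using uv nb_sym by simp
  show ?thesis
  proof (cases "u \<in> e")
    case True
    thus ?thesis using tail_if_witness_at[OF uv du ef(1) _ ef(2,4,5,6)] by blast
  next
    case False
    hence "v \<in> e" using ef(3) by blast
    have "tail v u"
      by (rule tail_if_witness_at[OF \<open>u \<in> nb v\<close> dv ef(1) \<open>v \<in> e\<close> ef(2,5,4)])
        (use ef(6) in \<open>simp add: insert_commute\<close>)
    thus ?thesis ..
  qed
qed

lemma card_nb_le_2: "nb y \<subseteq> {p, q} \<Longrightarrow> card (nb y) \<le> 2"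
  using card_mono[of "{p, q}" "nb y"] card_insert_le_m1[of 2 "{q}" p] by simp

section \<open>Codes are 2-degenerate\<close>

definition inside :: "'a set \<Rightarrow> 'a set set" where
  "inside W = {c \<in> C. c \<subseteq> W}"

definition touched :: "'a set \<Rightarrow> 'a set set" where
  "touched T = {c \<in> C. c \<inter> T \<noteq> {}}"

lemma card_inside_diff: "card C = card (inside (V - T)) + card (touched T)"
proof -
  have "C = inside (V - T) \<union> touched T"
    using C_sub E_sub by (auto simp: inside_def touched_def nsets_def)
  moreover have "inside (V - T) \<inter> touched T = {}"
    using C_sub E_sub by (auto simp: inside_def touched_def nsets_def)
  ultimately show ?thesis
    using card_Un_disjoint[of "inside (V - T)" "touched T"] finite_C
    by (simp add: inside_def touched_def)
qed

text \<open>If all degrees inside \<open>W\<close> were at least 3, then an edge inside \<open>W\<close> would be heavy and its tail,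
  having degree exactly 3, would have all its neighbours in \<open>W\<close>, among them one of degree at most 2.\<close>

lemma degenerate:
  assumes "W \<noteq> {}"
  shows "\<exists>w\<in>W. card (nb w \<inter> W) \<le> 2"
proof (rule ccontr)
  assume "\<not> ?thesis"
  hence big: "card (nb w \<inter> W) \<ge> 3" if "w \<in> W" for w using that by fastforce
  have big': "card (nb w) \<ge> 3" if "w \<in> W" for w
    using big[OF that] card_mono[OF finite_nb, of "nb w \<inter> W" w] by simp
  obtain u where u: "u \<in> W" using assms by auto
  hence "nb u \<inter> W \<noteq> {}" using big[OF u] by auto
  then obtain v where v: "v \<in> nb u" "v \<in> W" by auto
  have no: "\<not> tail a b" if "a \<in> W" for a b
  proof
    assume "tail a b"
    then obtain x y where xy: "nb a = {b, x, y}" "distinct [b, x, y]" "card (nb y) \<le> 2"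
      unfolding tail_def using card_nb_le_2 by (elim exE conjE disjE bexE) metis+
    have "card (nb a) = 3" using xy by simp
    hence "nb a \<inter> W = nb a" using big[OF that] by (intro card_seteq) (auto simp: finite_nb)
    hence "y \<in> W" using xy by auto
    thus False using big' xy by fastforce
  qed
  show False using heavy_edge_tail[OF v(1) big'[OF u] big'[OF v(2)]] no[OF u] no[OF v(2)] by simp
qed

lemma card_nb_image:
  "card {{v, w} | w. w \<in> A} = card A"
proof -
  have "{{v, w} | w. w \<in> A} = (\<lambda>w. {v, w}) ` A" by auto
  moreover have "inj_on (\<lambda>w. {v, w}) A" by (auto simp: inj_on_def doubleton_eq_iff)
  ultimately show ?thesis by (simp add: card_image)
qed

text \<open>Remove the vertices of \<open>W\<close> one at a time, always one with at most 2 remaining neighbours, until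
  two vertices with at most one edge are left.\<close>

lemma card_inside_le:
  assumes "W \<subseteq> V" "card W \<ge> 2"
  shows "card (inside W) + 3 \<le> 2 * card W"
  using assms
proof (induction "card W" arbitrary: W rule: less_induct)
  case less
  have fW: "finite W" using less.prems finite_V finite_subset by blast
  show ?case
  proof (cases "card W = 2")
    case True
    then obtain a b where "W = {a, b}" by (auto simp: card_2_iff)
    have "inside W \<subseteq> {W}"
    proof
      fix c assume c: "c \<in> inside W"
      then obtain x y where "c = {x, y}" "x \<noteq> y" by (auto simp: inside_def elim: C_obtain)
      thus "c \<in> {W}" using c \<open>W = {a, b}\<close> by (auto simp: inside_def)
    qed
    hence "card (inside W) \<le> 1" using card_mono[of "{W}"] by fastforce
    thus ?thesis using True by simp
  next
    case False
    hence "card W \<ge> 3" using less.prems by simp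
    hence "W \<noteq> {}" by auto
    then obtain w where w: "w \<in> W" "card (nb w \<inter> W) \<le> 2" using degenerate by blast
    let ?N = "{{w, z} | z. z \<in> nb w \<inter> W}"
    have "inside W \<subseteq> inside (W - {w}) \<union> ?N"
    proof
      fix c assume c: "c \<in> inside W"
      show "c \<in> inside (W - {w}) \<union> ?N"
      proof (cases "w \<in> c")
        case True
        have "c \<in> C" using c by (simp add: inside_def)
        then obtain z where "c = {w, z}" "z \<in> nb w" using True by (rule C_obtain_at)
        thus ?thesis using c by (auto simp: inside_def)
      next
        case False
        thus ?thesis using c by (auto simp: inside_def)
      qed
    qed
    moreover have "finite (inside (W - {w}) \<union> ?N)"
      using finite_nb finite_C by (auto simp: inside_def)
    ultimately have "card (inside W) \<le> card (inside (W - {w}) \<union> ?N)" by (rule card_mono[rotated])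
    also have "\<dots> \<le> card (inside (W - {w})) + card ?N" by (rule card_Un_le)
    finally have "card (inside W) \<le> card (inside (W - {w})) + card ?N" .
    hence "card (inside W) \<le> card (inside (W - {w})) + 2" using w card_nb_image[of w "nb w \<inter> W"] by simp
    moreover have "card (inside (W - {w})) + 3 \<le> 2 * card (W - {w})"
      using less.prems \<open>card W \<ge> 3\<close> w fW by (intro less.hyps) auto
    ultimately show ?thesis using w fW \<open>card W \<ge> 3\<close> by simp
  qed
qed


lemma touched_eq: "touched T = (\<Union>t\<in>T. (\<lambda>w. {t, w}) ` nb t)"
proof
  show "touched T \<subseteq> (\<Union>t\<in>T. (\<lambda>w. {t, w}) ` nb t)"
  proof
    fix c assume "c \<in> touched T"
    hence c: "c \<in> C" "c \<inter> T \<noteq> {}" by (simp_all add: touched_def)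
    then obtain t where t: "t \<in> T" "t \<in> c" by auto
    obtain w where "c = {t, w}" "w \<in> nb t" by (rule C_obtain_at[OF c(1) t(2)])
    thus "c \<in> (\<Union>t\<in>T. (\<lambda>w. {t, w}) ` nb t)" by (intro UN_I[OF t(1)] image_eqI)
  qed
  show "(\<Union>t\<in>T. (\<lambda>w. {t, w}) ` nb t) \<subseteq> touched T"
    by (auto simp: touched_def nb_def)
qed

text \<open>The count behind all global bounds: apart from the edges in \<open>F\<close>, each code edge is charged to
  one of its ends in \<open>S\<close>.\<close>

lemma card_C_le_cover:
  assumes "finite S" "finite F" and cover: "C \<subseteq> F \<union> touched S"
  shows "card C \<le> card F + (\<Sum>s\<in>S. card (nb s))"
proof -
  have "finite (touched S)" using finite_C by (simp add: touched_def)
  hence "card C \<le> card (F \<union> touched S)" using cover assms by (intro card_mono) auto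
  also have "\<dots> \<le> card F + card (touched S)" by (rule card_Un_le)
  also have "card (touched S) \<le> (\<Sum>s\<in>S. card ((\<lambda>w. {s, w}) ` nb s))"
    unfolding touched_eq by (rule card_UN_le[OF assms(1)])
  also have "\<dots> \<le> (\<Sum>s\<in>S. card (nb s))"
    by (intro sum_mono card_image_le finite_nb)
  finally show ?thesis by simp
qed

lemma handshake: "(\<Sum>v\<in>V. card (nb v)) = 2 * card C"
proof -
  have "card (nb v) = card {c \<in> C. v \<in> c}" for v
  proof -
    have star: "{c \<in> C. v \<in> c} = {{v, w} | w. w \<in> nb v}"
    proof
      show "{c \<in> C. v \<in> c} \<subseteq> {{v, w} | w. w \<in> nb v}"
        by (auto elim: C_obtain_at)
      show "{{v, w} | w. w \<in> nb v} \<subseteq> {c \<in> C. v \<in> c}"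
        by (auto simp: nb_def)
    qed
    show ?thesis unfolding star by (rule card_nb_image[symmetric])
  qed
  moreover have "card {v \<in> V. v \<in> c} = 2" if c: "c \<in> C" for c
  proof -
    obtain x y where "c = {x, y}" "x \<noteq> y" "x \<in> V" "y \<in> V" by (rule C_obtain[OF c])
    moreover from this have "{v \<in> V. v \<in> c} = {x, y}" by auto
    ultimately show ?thesis by simp
  qed
  ultimately show ?thesis
    using sum_multicount[OF finite_V finite_C, of "(\<in>)" 2] by simp
qed

end

lemma card_le_length: "A \<subseteq> set xs \<Longrightarrow> card A \<le> length xs"
  using card_mono[of "set xs" A] card_length[of xs] by simp

section \<open>Dense codes on at least five vertices\<close>

text \<open>The assumptions of the following locale are contradictory; this is the result of the section.\<close>

locale dense_code = irredundant_code +
  assumes order_ge_5: "card V \<ge> 5"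
    and dense: "2 * card V \<le> card C + 4"
begin

text \<open>Density turns the upper bound for the edges inside \<open>V - T\<close> into a lower bound for those that
  touch \<open>T\<close>. If \<open>V - T\<close> has a single vertex, it spans \<open>0\<close> edges rather than \<open>2 - 3\<close>, whence the
  loss of 1 in the second version.\<close>

lemma touched_ge:
  assumes "T \<subseteq> V" "card T + 2 \<le> card V"
  shows "2 * card T \<le> card (touched T) + 1"
proof -
  have "card (V - T) = card V - card T"
    using assms finite_V by (meson card_Diff_subset finite_subset)
  moreover have "card (inside (V - T)) + 3 \<le> 2 * card (V - T)"
    using assms calculation by (intro card_inside_le) auto
  ultimately show ?thesis using dense card_inside_diff[of T] assms by simp
qed

lemma touched_cocard_1_ge:
  assumes "T \<subseteq> V" "card T + 1 = card V"
  shows "2 * card T \<le> card (touched T) + 2"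
proof -
  have "card (V - T) = 1"
    using assms finite_V card_Diff_subset[of T V] finite_subset by fastforce
  then obtain z where z: "V - T = {z}" by (auto simp: card_1_singleton_iff)
  have "inside (V - T) = {}"
  proof (rule equals0I)
    fix c assume "c \<in> inside (V - T)"
    hence c: "c \<in> C" "c \<subseteq> {z}" by (auto simp: inside_def z)
    obtain x y where "c = {x, y}" "x \<noteq> y" by (rule C_obtain[OF c(1)])
    thus False using c by auto
  qed
  thus ?thesis using dense card_inside_diff[of T] assms by simp
qed

lemma touched_4_gt_5:
  assumes "T \<subseteq> V" "card T = 4"
  shows "card (touched T) > 5"
  using touched_ge[OF assms(1)] touched_cocard_1_ge[OF assms(1)] assms(2) order_ge_5
  by (cases "card V = 5") auto

text \<open>All other configurations around a tail \<open>u\<close> are too sparse: with the fourth vertex \<open>w\<close>, the four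
  vertices \<open>u, w, x, y\<close> touch only 5 edges, and with a light \<open>x\<close> the three vertices \<open>u, x, y\<close> touch
  only 4.\<close>

lemma tail_third_nb_heavy:
  assumes "tail u v"
  shows "\<exists>x y. nb u = {v, x, y} \<and> distinct [v, x, y] \<and> nb y \<subseteq> {u, x} \<and> card (nb x) \<ge> 3"
proof -
  from assms obtain x y where nbu: "nb u = {v, x, y}" and dist: "distinct [v, x, y]"
    and alt: "nb y \<subseteq> {u, x} \<or>
      (\<exists>w\<in>V. w \<notin> {u, x, y} \<and> nb x \<subseteq> {u, w} \<and> nb y \<subseteq> {u, w} \<and> nb w \<subseteq> {u, x, y})"
    unfolding tail_def by (elim exE conjE)
  have inV: "u \<in> V" "v \<in> V" "x \<in> V" "y \<in> V" using nb_in_V[of _ u] nbu by auto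
  have neq: "v \<noteq> u" "x \<noteq> u" "y \<noteq> u" using nb_irrefl[of u] nbu by auto
  have nby: "nb y \<subseteq> {u, x}"
  proof (rule ccontr)
    assume "\<not> ?thesis"
    then obtain w where w: "w \<in> V" "w \<notin> {u, x, y}" "nb x \<subseteq> {u, w}" "nb y \<subseteq> {u, w}" "nb w \<subseteq> {u, x, y}"
      using alt by (elim disjE bexE conjE) simp_all
    (* The edge uw is a code edge only if w = v, so it never adds a sixth edge. *)
    have uw: "w = v" if "u \<in> nb w"
    proof -
      have "w \<in> nb u" using that nb_sym by simp
      thus ?thesis using nbu w(2) by simp
    qed
    have "touched {u, w, x, y} \<subseteq> set [{u, v}, {u, x}, {u, y}, {w, x}, {w, y}]"
    proof
      fix c assume "c \<in> touched {u, w, x, y}"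
      then consider "c \<in> (\<lambda>z. {u, z}) ` nb u" | "c \<in> (\<lambda>z. {w, z}) ` nb w"
        | "c \<in> (\<lambda>z. {x, z}) ` nb x" | "c \<in> (\<lambda>z. {y, z}) ` nb y"
        by (auto simp: touched_eq)
      thus "c \<in> set [{u, v}, {u, x}, {u, y}, {w, x}, {w, y}]"
      proof cases
        case 1 thus ?thesis using nbu by auto
      next
        case 2
        then obtain z where "c = {w, z}" "z \<in> nb w" by auto
        thus ?thesis using w(5) uw by (auto simp: insert_commute)
      next
        case 3 thus ?thesis using w(3) by (auto simp: insert_commute)
      next
        case 4 thus ?thesis using w(4) by (auto simp: insert_commute)
      qed
    qed
    from card_le_length[OF this] have "card (touched {u, w, x, y}) \<le> 5" by simp
    moreover have "card {u, w, x, y} = 4" using w(2) neq dist by auto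
    ultimately show False using touched_4_gt_5[of "{u, w, x, y}"] inV w(1) by simp
  qed
  have "card (nb x) \<ge> 3"
  proof (rule ccontr)
    assume small: "\<not> ?thesis"
    have "u \<in> nb x" using nbu nb_sym[of u x] by simp
    hence "card (nb x - {u}) = 0 \<or> card (nb x - {u}) = 1" using small by auto
    then obtain z where z: "nb x - {u} \<subseteq> {z}"
      using finite_nb[of x] by (auto simp: card_1_singleton_iff)
    have "touched {u, x, y} \<subseteq> set [{u, v}, {u, x}, {u, y}, {x, z}]"
    proof
      fix c assume "c \<in> touched {u, x, y}"
      then consider "c \<in> (\<lambda>z. {u, z}) ` nb u" | "c \<in> (\<lambda>z. {x, z}) ` nb x" | "c \<in> (\<lambda>z. {y, z}) ` nb y"
        by (auto simp: touched_eq)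
      thus "c \<in> set [{u, v}, {u, x}, {u, y}, {x, z}]"
      proof cases
        case 1 thus ?thesis using nbu by auto
      next
        case 2 thus ?thesis using z by (auto simp: insert_commute)
      next
        case 3
        then obtain t where t: "c = {y, t}" "t \<in> nb y" by auto
        show ?thesis
        proof (cases "t = u")
          case False
          hence "t = x" using nby t by auto
          hence "y \<in> nb x" using t nb_sym by simp
          hence "y = z" using z neq by auto
          thus ?thesis using t \<open>t = x\<close> by (simp add: insert_commute)
        qed (use t in \<open>simp add: insert_commute\<close>)
      qed
    qed
    from card_le_length[OF this] have "card (touched {u, x, y}) \<le> 4" by simp
    moreover have "card {u, x, y} = 3" using neq dist by auto
    ultimately show False using touched_ge[of "{u, x, y}"] inV order_ge_5 by simp
  qed
  thus ?thesis using nbu dist nby by (intro exI[of _ x] exI[of _ y] conjI)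
qed

text \<open>The edge \<open>ux\<close> is heavy as well. Whichever of its ends is a tail, the light neighbour provided
  there is confined in a way that is incompatible with a triangle \<open>u, x, y\<close>.\<close>

lemma tail_pendant:
  assumes "tail u v"
  shows "\<exists>x y. nb u = {v, x, y} \<and> distinct [v, x, y] \<and> nb y = {u} \<and> card (nb x) \<ge> 3"
proof -
  obtain x y where nbu: "nb u = {v, x, y}" and dist: "distinct [v, x, y]"
    and nby: "nb y \<subseteq> {u, x}" and dx: "card (nb x) \<ge> 3"
    using tail_third_nb_heavy[OF assms] by (elim exE conjE)
  have neq: "v \<noteq> u" "x \<noteq> u" "y \<noteq> u" using nb_irrefl[of u] nbu by auto
  have "u \<in> nb y" "x \<in> nb u" using nbu nb_sym[of u y] by auto
  have dy: "card (nb y) \<le> 2" using nby by (rule card_nb_le_2)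
  have du: "card (nb u) \<ge> 3" using nbu dist by simp
  have "x \<notin> nb y"
  proof
    assume "x \<in> nb y"
    from heavy_edge_tail[OF \<open>x \<in> nb u\<close> du dx] show False
    proof
      assume "tail u x"
      then obtain x2 y2 where 2: "nb u = {x, x2, y2}" "distinct [x, x2, y2]" "nb y2 \<subseteq> {u, x2}" "card (nb x2) \<ge> 3"
        using tail_third_nb_heavy by blast
      have "x2 \<noteq> y" using dy 2(4) by auto
      hence "y2 = y" using nbu 2(1,2) dist by auto
      thus False using \<open>x \<in> nb y\<close> 2(2,3) neq by auto
    next
      assume "tail x u"
      then obtain x2 y2 where 2: "nb x = {u, x2, y2}" "distinct [u, x2, y2]" "nb y2 \<subseteq> {x, x2}" "card (nb x2) \<ge> 3"
        using tail_third_nb_heavy by blast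
      have "y \<in> nb x" using \<open>x \<in> nb y\<close> nb_sym by simp
      moreover have "x2 \<noteq> y" using dy 2(4) by auto
      ultimately have "y2 = y" using 2(1) neq by auto
      thus False using \<open>u \<in> nb y\<close> 2(2,3) neq by auto
    qed
  qed
  hence "nb y = {u}" using nby \<open>u \<in> nb y\<close> by auto
  thus ?thesis using nbu dist dx by (intro exI[of _ x] exI[of _ y] conjI)
qed

text \<open>Two tails would have two different neighbours of degree 1, which together touch only 2 edges.\<close>

lemma tail_unique:
  assumes "tail u v" "tail u' v'" shows "u = u'"
proof (rule ccontr)
  assume "u \<noteq> u'"
  obtain y y' where y: "nb y = {u}" "nb y' = {u'}"
    using tail_pendant assms by metis
  have "y \<noteq> y'" using y \<open>u \<noteq> u'\<close> by auto
  have "touched {y, y'} \<subseteq> set [{y, u}, {y', u'}]" using y by (auto simp: touched_eq)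
  from card_le_length[OF this] have "card (touched {y, y'}) \<le> 2" by simp
  moreover have "y \<in> V" "y' \<in> V" using nb_in_V y by blast+
  ultimately show False using touched_ge[of "{y, y'}"] \<open>y \<noteq> y'\<close> order_ge_5 by simp
qed

definition light :: "'a set" where
  "light = {v \<in> V. card (nb v) \<le> 2}"

lemma finite_light: "finite light"
  using finite_V by (simp add: light_def)

lemma sum_light_le:
  assumes "A \<subseteq> light" shows "(\<Sum>s\<in>A. card (nb s)) \<le> 2 * card A"
  using sum_bounded_above[of A "\<lambda>s. card (nb s)" 2] assms by (auto simp: light_def mult.commute)

text \<open>The tail \<open>u\<close> lies on all heavy edges, so the only candidates are \<open>uv\<close> and \<open>ux\<close>. The other code
  edges are charged to the light vertices, of which there are at most \<open>n - 3\<close> since \<open>u\<close>, \<open>v\<close> and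
  \<open>x\<close> are not light; \<open>y\<close> receives only one edge.\<close>

lemma no_heavy_edge:
  assumes "v \<in> nb u" "card (nb u) \<ge> 3" "card (nb v) \<ge> 3"
  shows False
proof -
  have main: False if tl: "tail u v" and dv: "card (nb v) \<ge> 3" for u v
  proof -
    obtain x y where nbu: "nb u = {v, x, y}" and dist: "distinct [v, x, y]"
      and nby: "nb y = {u}" and dx: "card (nb x) \<ge> 3"
      using tail_pendant[OF tl] by (elim exE conjE)
    have inV: "u \<in> V" "v \<in> V" "x \<in> V" "y \<in> V" using nb_in_V[of _ u] nbu by auto
    have neq: "v \<noteq> u" "x \<noteq> u" "y \<noteq> u" using nb_irrefl[of u] nbu by auto
    have du: "card (nb u) \<ge> 3" using nbu dist by simp
    have y: "y \<in> light" using nby inV by (simp add: light_def)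
    have "C \<subseteq> {{u, v}, {u, x}} \<union> touched light"
    proof
      fix c assume c: "c \<in> C"
      obtain p q where pq: "c = {p, q}" "p \<in> V" "q \<in> V" by (rule C_obtain[OF c])
      show "c \<in> {{u, v}, {u, x}} \<union> touched light"
      proof (cases "p \<in> light \<or> q \<in> light")
        case True
        thus ?thesis using c pq by (auto simp: touched_def)
      next
        case False
        have q: "q \<in> nb p" "p \<in> nb q" using c pq by (auto simp: nb_def insert_commute)
        have "card (nb p) \<ge> 3" "card (nb q) \<ge> 3" using False pq by (auto simp: light_def)
        hence "tail p q \<or> tail q p" using heavy_edge_tail q by blast
        hence "p = u \<or> q = u" using tail_unique[OF _ tl] by blast
        then obtain r where "c = {u, r}" "r \<in> nb u" "r \<notin> light"
          using q pq False by (auto simp: insert_commute)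
        moreover from this have "r = v \<or> r = x" using nbu y by auto
        ultimately show ?thesis by auto
      qed
    qed
    hence "card C \<le> card {{u, v}, {u, x}} + (\<Sum>s\<in>light. card (nb s))"
      by (rule card_C_le_cover[OF finite_light, rotated]) simp
    also have "(\<Sum>s\<in>light. card (nb s)) = card (nb y) + (\<Sum>s\<in>light - {y}. card (nb s))"
      by (rule sum.remove[OF finite_light y])
    also have "(\<Sum>s\<in>light - {y}. card (nb s)) \<le> 2 * card (light - {y})"
      by (rule sum_light_le) auto
    finally have "card C \<le> 2 + 1 + 2 * (card light - 1)"
      using nby y finite_light card_le_length[of "{{u, v}, {u, x}}" "[{u, v}, {u, x}]"] by simp
    moreover have "card light \<le> card V - 3"
    proof -
      have "light \<subseteq> V - {u, v, x}" using du dv dx by (auto simp: light_def)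
      hence "card light \<le> card (V - {u, v, x})" using finite_V by (intro card_mono) auto
      also have "\<dots> = card V - 3" using inV neq dist finite_V by (subst card_Diff_subset) auto
      finally show ?thesis .
    qed
    moreover have "card light \<ge> 1" using card_gt_0_iff[of light] y finite_light by (auto simp: Suc_le_eq)
    ultimately show False using dense order_ge_5 by simp
  qed
  show False using heavy_edge_tail[OF assms] main assms by blast
qed

definition heavy :: "'a set" where
  "heavy = V - light"

lemma heavy_iff: "v \<in> heavy \<longleftrightarrow> v \<in> V \<and> card (nb v) \<ge> 3"
  by (auto simp: heavy_def light_def)

lemma finite_heavy: "finite heavy"
  using finite_V by (simp add: heavy_def)

lemma card_light: "card light = card V - card heavy" "card heavy \<le> card V"
proof -
  have "light = V - heavy" by (auto simp: heavy_def light_def)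
  thus "card light = card V - card heavy"
    using card_Diff_subset[OF finite_heavy, of V] by (auto simp: heavy_def)
  show "card heavy \<le> card V" using finite_V by (intro card_mono) (auto simp: heavy_def)
qed

lemma C_subset_touched_light: "C \<subseteq> touched light"
proof
  fix c assume c: "c \<in> C"
  obtain p q where pq: "c = {p, q}" "p \<in> V" "q \<in> V" by (rule C_obtain[OF c])
  have "q \<in> nb p" using c pq by (simp add: nb_def)
  hence "p \<in> light \<or> q \<in> light" using no_heavy_edge pq by (fastforce simp: light_def)
  thus "c \<in> touched light" using c pq by (auto simp: touched_def)
qed

text \<open>Charge the edges at \<open>s\<close> whose other end is light to that other end. Then \<open>s\<close> pays only for its
  heavy neighbours, and density forces it to have many of them.\<close>

lemma heavy_nbs_of_light:
  assumes s: "s \<in> light"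
  shows "2 * card heavy \<le> card (nb s \<inter> heavy) + 2"
proof -
  let ?F = "(\<lambda>w. {s, w}) ` (nb s \<inter> heavy)"
  have "C \<subseteq> ?F \<union> touched (light - {s})"
  proof
    fix c assume c: "c \<in> C"
    show "c \<in> ?F \<union> touched (light - {s})"
    proof (cases "s \<in> c")
      case False
      thus ?thesis using c C_subset_touched_light by (auto simp: touched_def)
    next
      case True
      obtain w where w: "c = {s, w}" "w \<in> nb s" by (rule C_obtain_at[OF c True])
      have "w \<noteq> s" "w \<in> V" using w nb_irrefl nb_in_V by auto
      thus ?thesis using w c by (cases "w \<in> light") (auto simp: touched_def heavy_def)
    qed
  qed
  hence "card C \<le> card ?F + (\<Sum>s\<in>light - {s}. card (nb s))"
    using finite_light finite_nb by (intro card_C_le_cover) auto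
  also have "(\<Sum>s\<in>light - {s}. card (nb s)) \<le> 2 * card (light - {s})"
    by (rule sum_light_le) auto
  also have "card ?F \<le> card (nb s \<inter> heavy)" using finite_nb by (intro card_image_le) auto
  finally have "card C \<le> card (nb s \<inter> heavy) + 2 * (card light - 1)" using s finite_light by simp
  moreover have "card light \<ge> 1" using card_gt_0_iff[of light] s finite_light by (auto simp: Suc_le_eq)
  ultimately show ?thesis using dense card_light by simp
qed

lemma card_heavy_le_2: "card heavy \<le> 2"
proof -
  have "light \<noteq> {}"
    using C_subset_touched_light dense order_ge_5 by (auto simp: touched_def)
  then obtain s where s: "s \<in> light" by auto
  have "card (nb s \<inter> heavy) \<le> card (nb s)" using finite_nb by (intro card_mono) auto
  also have "\<dots> \<le> 2" using s by (simp add: light_def)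
  finally show ?thesis using heavy_nbs_of_light[OF s] by simp
qed

text \<open>Here \<open>C\<close> would be complete bipartite between the heavy vertices \<open>a, b\<close> and the light ones. Consider
  the witnesses \<open>e\<close>, \<open>f\<close> for an edge \<open>as\<close>. Whether or not \<open>f\<close> passes through \<open>b\<close>, the edge \<open>e\<close>
  would need three vertices to meet the right code edges.\<close>

lemma card_heavy_neq_2: "card heavy \<noteq> 2"
proof
  assume 2: "card heavy = 2"
  then obtain a b where ab: "heavy = {a, b}" "a \<noteq> b" by (auto simp: card_2_iff)
  have nb_light: "nb s = {a, b}" if s: "s \<in> light" for s
  proof -
    have "card (nb s \<inter> heavy) \<ge> card heavy" using heavy_nbs_of_light[OF s] 2 by simp
    hence "nb s \<inter> heavy = heavy" using finite_heavy by (intro card_seteq) auto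
    moreover have "card (nb s) \<le> card heavy" using s 2 by (simp add: light_def)
    ultimately show ?thesis using ab finite_nb by (metis Int_lower1 card_seteq)
  qed
  have big: "card light \<ge> 3" using card_light 2 order_ge_5 by simp
  then obtain s where s: "s \<in> light" by fastforce
  have sab: "s \<noteq> a" "s \<noteq> b" using s ab by (auto simp: heavy_def)
  have as: "s \<in> nb a" using nb_light[OF s] nb_sym by blast
  have da: "card (nb a) \<ge> 2" using ab heavy_iff[of a] by simp
  have ds: "card (nb s) \<ge> 2" using nb_light[OF s] ab by simp
  obtain e f where ef: "e \<in> E" "f \<in> E" "e \<noteq> f" "a \<in> e \<or> s \<in> e" "a \<notin> f" "s \<notin> f"
    and same: "\<And>p q. q \<in> nb p \<Longrightarrow> {p, q} \<noteq> {a, s} \<Longrightarrow> (p \<in> e \<or> q \<in> e) \<longleftrightarrow> (p \<in> f \<or> q \<in> f)"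
    by (rule witness[OF as da ds]) auto
  obtain e1 e2 where e: "e = {e1, e2}" by (rule edge_obtain[OF subsetD[OF E_sub ef(1)]])
  obtain f1 f2 where f: "f = {f1, f2}" "f1 \<noteq> f2" "f1 \<in> V" "f2 \<in> V"
    by (rule edge_obtain[OF subsetD[OF E_sub ef(2)]])
  have at_b: "(t \<in> e \<or> b \<in> e) \<longleftrightarrow> (t \<in> f \<or> b \<in> f)" if "t \<in> light" for t
    using same[of b t] nb_light[OF that] ab sab by (auto simp: doubleton_eq_iff)
  have at_a: "(t \<in> e \<or> a \<in> e) \<longleftrightarrow> t \<in> f" if "t \<in> light" "t \<noteq> s" for t
    using same[of a t] nb_light[OF that(1)] that(2) ef(5) by (auto simp: doubleton_eq_iff)
  show False
  proof (cases "b \<in> f")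
    case True
    obtain t where t: "f = {b, t}" "t \<noteq> b" "t \<in> V"
      by (rule edge_obtain_at[OF subsetD[OF E_sub ef(2)] True])
    have ts: "t \<in> light" "t \<noteq> s" using t ef ab by (auto simp: heavy_def)
    have "card {s, t} < card light" using big ts(2) by simp
    then obtain z where z: "z \<in> light" "z \<noteq> s" "z \<noteq> t"
      by (metis card_mono finite.emptyI finite_insert insertCI linorder_not_le subsetI)
    have "z \<noteq> b" using z ab by (auto simp: heavy_def)
    hence "z \<notin> e" "a \<notin> e" using at_a[OF z(1,2)] t z by auto
    moreover have "t \<in> e" using at_a[OF ts] t \<open>a \<notin> e\<close> by simp
    moreover have "b \<in> e" using at_b[OF z(1)] t \<open>z \<notin> e\<close> by simp
    moreover have "s \<in> e" using ef(4) \<open>a \<notin> e\<close> by simp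
    ultimately show False using e ts t sab by auto
  next
    case False
    have "f1 \<in> light" "f2 \<in> light" using f False ef(5) ab by (auto simp: heavy_def)
    moreover have "b \<notin> e" "s \<notin> e" using at_b[OF s] ef(6) False by auto
    ultimately have "f1 \<in> e" "f2 \<in> e" using at_b f by auto
    moreover have "a \<in> e" using ef(4) \<open>s \<notin> e\<close> by simp
    ultimately show False using e f ef(5) by auto
  qed
qed

text \<open>The code would consist of triangles sharing the vertex \<open>b\<close>. In a triangle \<open>b, s, t\<close>, witnesses for
  \<open>bs\<close> would have to be \<open>e = st\<close> and \<open>f = tz\<close> for some \<open>z\<close> in another triangle, but these are
  distinguished by \<open>bz\<close>.\<close>

lemma no_dominating_vertex:
  assumes b: "nb b = V - {b}" and two: "\<And>s. s \<in> V - {b} \<Longrightarrow> card (nb s) = 2"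
  shows False
proof -
  have "V - {b} \<noteq> {}" using diff_card_le_card_Diff[of "{b}" V] order_ge_5 by force
  then obtain z where "z \<in> nb b" using b by auto
  hence bV: "b \<in> V" by (rule nb_in_V)
  have db: "card (nb b) \<ge> 4" using b bV finite_V order_ge_5 by simp
  then obtain s where s: "s \<in> nb b" using ex_other_nb[of b] by force
  have sV: "s \<in> V" "s \<noteq> b" using s b by auto
  have "b \<in> nb s" using s nb_sym by simp
  obtain t where t: "t \<in> nb s" "t \<noteq> b" using ex_other_nb[of s b] two[of s] sV by auto
  have tV: "t \<in> nb b" "t \<noteq> s" using t nb_in_V nb_irrefl b by auto
  have db2: "card (nb b) \<ge> 2" and ds: "card (nb s) \<ge> 2" using db two[of s] sV by auto
  obtain e f where ef: "e \<in> E" "f \<in> E" "e \<noteq> f" "b \<in> e \<or> s \<in> e" "b \<notin> f" "s \<notin> f"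
    and same: "\<And>p q. q \<in> nb p \<Longrightarrow> {p, q} \<noteq> {b, s} \<Longrightarrow> (p \<in> e \<or> q \<in> e) \<longleftrightarrow> (p \<in> f \<or> q \<in> f)"
    by (rule witness[OF s db2 ds]) auto
  have at_b: "(z \<in> e \<or> b \<in> e) \<longleftrightarrow> z \<in> f" if "z \<in> nb b" "z \<noteq> s" for z
    using same[of z b] that ef(5) by (auto simp: doubleton_eq_iff)
  have cf: "finite f" "card f = 2" using subsetD[OF E_sub ef(2)] by (auto simp: nsets_def)
  (* An e through b would force f to contain the at least three other neighbours of b. *)
  have "b \<notin> e"
  proof
    assume "b \<in> e"
    hence "nb b - {s} \<subseteq> f" using at_b by auto
    hence "card (nb b - {s}) \<le> 2" using cf card_mono by fastforce
    thus False using db s by simp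
  qed
  hence "s \<in> e" using ef(4) by simp
  hence "t \<in> f" using same[OF t(1)] ef(6) t(2) tV(2) by (auto simp: doubleton_eq_iff)
  hence "t \<in> e" using at_b[OF tV] \<open>b \<notin> e\<close> by simp
  obtain e' where e': "e = {s, e'}" by (rule edge_obtain_at[OF subsetD[OF E_sub ef(1)] \<open>s \<in> e\<close>])
  have "e = {s, t}" using e' \<open>t \<in> e\<close> tV(2) by auto
  obtain z where z: "f = {t, z}" "z \<noteq> t" "z \<in> V"
    by (rule edge_obtain_at[OF subsetD[OF E_sub ef(2)] \<open>t \<in> f\<close>])
  have "z \<in> nb b" "z \<noteq> s" using z ef b by auto
  hence "z \<in> e" using at_b z \<open>b \<notin> e\<close> by simp
  thus False using \<open>e = {s, t}\<close> z \<open>z \<noteq> s\<close> by simp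
qed

text \<open>With at most one heavy vertex the degree sum is at most \<open>(n - 1) + 2 (n - 1)\<close>, while density
  makes it at least \<open>4 n - 8\<close>. So \<open>n = 5\<close> and all degree bounds are attained.\<close>

lemma no_dense_code: False
proof -
  have light_le: "(\<Sum>s\<in>light. card (nb s)) \<le> 2 * card light" by (rule sum_light_le) simp
  consider "card heavy = 0" | "card heavy = 1" using card_heavy_le_2 card_heavy_neq_2 by linarith
  thus False
  proof cases
    case 1
    hence "light = V" using finite_heavy by (auto simp: heavy_def light_def)
    thus False using light_le handshake dense order_ge_5 by simp
  next
    case 2
    then obtain b where b: "heavy = {b}" by (auto simp: card_1_singleton_iff)
    have bV: "b \<in> V" "light = V - {b}" using b by (auto simp: heavy_def light_def)
    have nbb: "nb b \<subseteq> V - {b}" using nb_in_V nb_irrefl by auto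
    have cVb: "card (V - {b}) = card V - 1" using bV finite_V by simp
    have dbl: "card (nb b) \<le> card V - 1" using card_mono[OF _ nbb] finite_V cVb by simp
    have tot: "2 * card C = card (nb b) + (\<Sum>s\<in>light. card (nb s))"
      using handshake sum.remove[OF finite_V bV(1), of "\<lambda>v. card (nb v)"] bV by simp
    have V5: "card V = 5" using tot dbl light_le dense order_ge_5 bV cVb by simp
    have "nb b = V - {b}"
    proof (rule card_seteq[OF _ nbb])
      show "card (V - {b}) \<le> card (nb b)" using tot light_le dense V5 bV cVb by simp
    qed (use finite_V in simp)
    moreover have "card (nb s) = 2" if s: "s \<in> V - {b}" for s
    proof -
      have "(\<Sum>s\<in>light. card (nb s)) = card (nb s) + (\<Sum>s\<in>light - {s}. card (nb s))"
        using s bV by (intro sum.remove finite_light) auto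
      moreover have "(\<Sum>s\<in>light - {s}. card (nb s)) \<le> 2 * card (light - {s})"
        by (rule sum_light_le) auto
      moreover have "card (light - {s}) = 3" using s bV cVb V5 finite_V by simp
      moreover have "card (nb s) \<le> 2" using s bV by (auto simp: light_def)
      ultimately show ?thesis using tot dbl dense V5 by simp
    qed
    ultimately show False by (rule no_dominating_vertex)
  qed
qed

end

lemma (in irredundant_code) card_le_if_order_ge_5:
  assumes "card V \<ge> 5"
  shows "card C + 5 \<le> 2 * card V"
proof (rule ccontr)
  assume "\<not> ?thesis"
  then interpret dense_code V E C
    by unfold_locales (use assms in auto)
  show False by (rule no_dense_code)
qed


section \<open>Graphs on at most four vertices\<close>

lemma is_complete_nsets:
  assumes "finite V"
  shows "is_complete (card V) V ([V]\<^bsup>2\<^esup>)"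
proof -
  obtain \<phi> where "bij_betw \<phi> V {0..<card V}"
    using ex_bij_betw_finite_nat[OF assms] by blast
  hence \<phi>: "bij_betw \<phi> V {..<card V}" by (simp add: lessThan_atLeast0)
  have "{x, y} \<in> [V]\<^bsup>2\<^esup> \<longleftrightarrow> {\<phi> x, \<phi> y} \<in> [{..<card V}]\<^bsup>2\<^esup>" if "x \<in> V" "y \<in> V" for x y
  proof -
    have "\<phi> x < card V" "\<phi> y < card V" using bij_betwE[OF \<phi>] that by auto
    moreover have "\<phi> x = \<phi> y \<longleftrightarrow> x = y"
      using bij_betw_imp_inj_on[OF \<phi>] that by (auto simp: inj_on_def)
    ultimately show ?thesis using that by (auto simp: nsets_def card_insert_if)
  qed
  thus ?thesis unfolding is_complete_def graph_iso_def using \<phi> by blast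
qed

lemma edges_on_4:
  assumes "distinct [a, b, c, d]"
  shows "[{a, b, c, d}]\<^bsup>2\<^esup> = {{a, b}, {a, c}, {a, d}, {b, c}, {b, d}, {c, d}}"
proof
  show "[{a, b, c, d}]\<^bsup>2\<^esup> \<subseteq> {{a, b}, {a, c}, {a, d}, {b, c}, {b, d}, {c, d}}"
  proof
    fix e assume "e \<in> [{a, b, c, d}]\<^bsup>2\<^esup>"
    then obtain x y where "e = {x, y}" "x \<noteq> y" "x \<in> {a, b, c, d}" "y \<in> {a, b, c, d}"
      by (rule edge_obtain)
    thus "e \<in> {{a, b}, {a, c}, {a, d}, {b, c}, {b, d}, {c, d}}"
      by (auto simp: insert_commute)
  qed
  show "{{a, b}, {a, c}, {a, d}, {b, c}, {b, d}, {c, d}} \<subseteq> [{a, b, c, d}]\<^bsup>2\<^esup>"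
    using assms by (auto simp: nsets_def)
qed

lemma obtain_fourth:
  assumes "card V = 4" "distinct [a, b, c]" "{a, b, c} \<subseteq> V"
  obtains d where "V = {a, b, c, d}" "distinct [a, b, c, d]"
proof -
  have "finite V" using assms(1) by (simp add: card_ge_0_finite)
  hence "card (V - {a, b, c}) = 1" using assms by (subst card_Diff_subset) auto
  then obtain d where d: "V - {a, b, c} = {d}" by (auto simp: card_1_singleton_iff)
  have "V = {a, b, c, d}" "d \<notin> {a, b, c}" using d assms(3) by blast+
  thus ?thesis using that assms(2) by auto
qed

lemma is_K4_minus_one_missing:
  assumes V: "card V = 4" and g: "g \<in> [V]\<^bsup>2\<^esup>"
  shows "is_K4_minus V ([V]\<^bsup>2\<^esup> - {g})"
proof -
  obtain a b where ab: "g = {a, b}" "a \<noteq> b" "a \<in> V" "b \<in> V" by (rule edge_obtain[OF g])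
  have "\<not> V \<subseteq> {a, b}" using V card_le_length[of V "[a, b]"] by auto
  then obtain c where "c \<in> V" "c \<notin> {a, b}" by auto
  hence "distinct [a, b, c]" "{a, b, c} \<subseteq> V" using ab by auto
  then obtain d where d: "V = {a, b, c, d}" "distinct [a, b, c, d]" by (rule obtain_fourth[OF V])
  have lt4: "{..<4} = {0, 1, 2, 3::nat}" by auto
  have eN: "[{..<4::nat}]\<^bsup>2\<^esup> = {{0, 1}, {0, 2}, {0, 3}, {1, 2}, {1, 3}, {2, 3}}"
    unfolding lt4 by (rule edges_on_4) simp
  define \<phi> where "\<phi> = (\<lambda>x. if x = a then 0 else if x = b then 1 else if x = c then 2 else 3::nat)"
  have \<phi>: "\<phi> a = 0" "\<phi> b = 1" "\<phi> c = 2" "\<phi> d = 3" using d(2) by (auto simp: \<phi>_def)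
  have "bij_betw \<phi> V {..<4}"
    unfolding bij_betw_def lt4 using d(2) by (auto simp: d(1) \<phi> inj_on_def)
  moreover have "{x, y} \<in> [V]\<^bsup>2\<^esup> - {g} \<longleftrightarrow> {\<phi> x, \<phi> y} \<in> [{..<4}]\<^bsup>2\<^esup> - {{0, 1}}"
    if "x \<in> V" "y \<in> V" for x y
  proof -
    have "{x, y} \<in> [V]\<^bsup>2\<^esup> - {g} \<longleftrightarrow> x \<noteq> y \<and> {x, y} \<noteq> {a, b}"
      using that by (auto simp: nsets_def ab(1) card_insert_if)
    moreover have "{\<phi> x, \<phi> y} \<in> [{..<4}]\<^bsup>2\<^esup> - {{0, 1}} \<longleftrightarrow> \<phi> x \<noteq> \<phi> y \<and> {\<phi> x, \<phi> y} \<noteq> {0, 1}"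
      using bij_betwE[OF \<open>bij_betw \<phi> V {..<4}\<close>] that by (auto simp: nsets_def card_insert_if)
    moreover have "\<phi> x = \<phi> y \<longleftrightarrow> x = y"
      using bij_betw_imp_inj_on[OF \<open>bij_betw \<phi> V {..<4}\<close>] that by (auto simp: inj_on_def)
    moreover have "\<phi> z = 0 \<longleftrightarrow> z = a" "\<phi> z = 1 \<longleftrightarrow> z = b" for z
      using ab(2) by (auto simp: \<phi>_def)
    ultimately show ?thesis by (simp add: doubleton_eq_iff)
  qed
  ultimately show ?thesis
    unfolding is_K4_minus_def graph_iso_def by (intro exI[of _ \<phi>] conjI ballI)
qed

context irredundant_code
begin

lemma card_le_3_if_order_4:
  assumes V: "card V = 4" and pf: "pendant_free E"
    and K4: "\<not> is_complete 4 V E" and K4m: "\<not> is_K4_minus V E"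
  shows "card C \<le> 3"
proof (rule ccontr)
  assume "\<not> ?thesis"
  hence C4: "card C \<ge> 4" by simp
  let ?M = "[V]\<^bsup>2\<^esup> - E"
  have fin: "finite ([V]\<^bsup>2\<^esup>)" using finite_V by (simp add: finite_imp_finite_nsets)
  hence fE: "finite E" using E_sub finite_subset by blast
  have "card ([V]\<^bsup>2\<^esup>) = 6" using V by (simp add: choose_two)
  hence cE: "card E + card ?M = 6" using card_Diff_subset[OF fE E_sub] card_mono[OF fin E_sub] by simp
  have "?M \<noteq> {}" using K4 is_complete_nsets[OF finite_V] E_sub V by force
  hence "card ?M \<noteq> 0" using fin by simp
  moreover have "card ?M \<noteq> 1"
  proof
    assume "card ?M = 1"
    then obtain g where g: "?M = {g}" by (auto simp: card_1_singleton_iff)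
    hence "E = [V]\<^bsup>2\<^esup> - {g}" "g \<in> [V]\<^bsup>2\<^esup>" using E_sub by blast+
    thus False using K4m is_K4_minus_one_missing[OF V] by simp
  qed
  moreover have "card C \<le> card E" using card_mono[OF fE C_sub] .
  ultimately have "card ?M = 2" "card C = card E" using C4 cE by linarith+
  hence CE: "C = E" using card_subset_eq[OF fE C_sub] by simp
  obtain g h where gh: "?M = {g, h}" "g \<noteq> h" using \<open>card ?M = 2\<close> by (auto simp: card_2_iff)
  have E_eq: "E = [V]\<^bsup>2\<^esup> - {g, h}" using gh E_sub by blast
  have gV: "g \<in> [V]\<^bsup>2\<^esup>" and hV: "h \<in> [V]\<^bsup>2\<^esup>" using gh by blast+
  show False
  proof (cases "g \<inter> h = {}")
    case False
    then obtain a where a: "a \<in> g" "a \<in> h" by auto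
    obtain b where b: "g = {a, b}" "b \<noteq> a" "b \<in> V" by (rule edge_obtain_at[OF gV a(1)])
    obtain c where c: "h = {a, c}" "c \<noteq> a" "c \<in> V" by (rule edge_obtain_at[OF hV a(2)])
    have "a \<in> V" using a gV by (auto simp: nsets_def)
    hence "distinct [a, b, c]" "{a, b, c} \<subseteq> V" using b c gh(2) by auto
    then obtain d where d: "V = {a, b, c, d}" "distinct [a, b, c, d]" by (rule obtain_fourth[OF V])
    have E: "E = {{a, d}, {b, c}, {b, d}, {c, d}}"
      unfolding E_eq d(1) edges_on_4[OF d(2)] b(1) c(1) using d(2) by (auto simp: doubleton_eq_iff)
    have "{e \<in> E. b \<in> e} = {{b, c}, {b, d}}" "{e \<in> E. c \<in> e} = {{b, c}, {c, d}}"
      using d(2) by (auto simp: E)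
    hence "degree E b = 2" "degree E c = 2" using d(2) by (auto simp: degree_def doubleton_eq_iff)
    moreover have "{d, b} \<in> E" "{d, c} \<in> E" "{b, c} \<in> E" by (auto simp: E insert_commute)
    moreover have "b \<noteq> c" using d(2) by simp
    ultimately have "pendant_pair E {d, b} {d, c}" unfolding pendant_pair_def by blast
    thus False using pf by (auto simp: pendant_free_def)
  next
    case True
    obtain a b where ab: "g = {a, b}" "a \<noteq> b" "a \<in> V" "b \<in> V" by (rule edge_obtain[OF gV])
    obtain c d where cd: "h = {c, d}" "c \<noteq> d" "c \<in> V" "d \<in> V" by (rule edge_obtain[OF hV])
    have dist: "distinct [a, b, c, d]" using True ab cd by auto
    have "card {a, b, c, d} = 4" using dist by auto
    hence Veq: "V = {a, b, c, d}" using card_subset_eq[OF finite_V, of "{a, b, c, d}"] ab cd V by auto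
    have E: "E = {{a, c}, {a, d}, {b, c}, {b, d}}"
      unfolding E_eq Veq edges_on_4[OF dist] ab(1) cd(1) using dist by (auto simp: doubleton_eq_iff)
    have nb: "nb a = {c, d}" "nb b = {c, d}" "nb c = {a, b}"
      unfolding nb_def unfolding CE E using dist by (auto simp: doubleton_eq_iff)
    have ac: "c \<in> nb a" and da: "card (nb a) \<ge> 2" and dc: "card (nb c) \<ge> 2" using nb dist by auto
    obtain e f where ef: "e \<in> E" "f \<in> E" "e \<noteq> f" "a \<in> e \<or> c \<in> e" "a \<notin> f" "c \<notin> f"
      and same: "\<And>p q. q \<in> nb p \<Longrightarrow> {p, q} \<noteq> {a, c} \<Longrightarrow> (p \<in> e \<or> q \<in> e) \<longleftrightarrow> (p \<in> f \<or> q \<in> f)"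
      by (rule witness[OF ac da dc]) auto
    have f: "f = {b, d}" using ef(2,5,6) dist by (auto simp: E)
    have "b \<in> e \<or> d \<in> e" "a \<in> e \<or> d \<in> e" "b \<in> e \<or> c \<in> e"
      using same[of d b] same[of d a] same[of c b] nb dist f by (auto simp: doubleton_eq_iff)
    thus False using ef(1,3) f dist by (auto simp: E)
  qed
qed

lemma card_le_1_if_order_3:
  assumes V: "card V = 3"
  shows "card C \<le> 1"
proof -
  (* Any two edges on three vertices meet, so no code edge can distinguish two of them. *)
  have "e = f" if e: "e \<in> E" and f: "f \<in> E" for e f
  proof (rule ccontr)
    assume "e \<noteq> f"
    obtain c where c: "c \<in> C" "(c \<inter> e \<noteq> {}) \<noteq> (c \<inter> f \<noteq> {})"
      using separated[OF e f \<open>e \<noteq> f\<close>] by (elim bexE)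
    have meet: "g \<inter> h \<noteq> {}" if g: "g \<in> [V]\<^bsup>2\<^esup>" and h: "h \<in> [V]\<^bsup>2\<^esup>" for g h
    proof
      assume "g \<inter> h = {}"
      hence "card (g \<union> h) = 4" using g h card_Un_disjoint[of g h] by (auto simp: nsets_def)
      moreover have "card (g \<union> h) \<le> card V" using g h finite_V by (intro card_mono) (auto simp: nsets_def)
      ultimately show False using V by simp
    qed
    have "c \<in> [V]\<^bsup>2\<^esup>" "e \<in> [V]\<^bsup>2\<^esup>" "f \<in> [V]\<^bsup>2\<^esup>"
      using c(1) e f C_sub E_sub by blast+
    thus False using c(2) meet[of c e] meet[of c f] by simp
  qed
  hence "\<And>e f. e \<in> C \<Longrightarrow> f \<in> C \<Longrightarrow> e = f" using C_sub by blast
  thus ?thesis using card_le_Suc0_iff_eq[OF finite_C] by simp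
qed

end

section \<open>The bound\<close>

theorem corollary20:
  fixes V :: "'a set" and E :: "'a set set"
  assumes "simple_graph V E"
    and "pendant_free E"
    and "\<not> is_complete 4 V E"
    and "\<not> is_K4_minus V E"
    and "\<not> is_complete 2 V E"
  shows "int (gamma_EID E) \<le> 2 * int (card V) - 5"
proof -
  have fV: "finite V" and EV: "E \<subseteq> [V]\<^bsup>2\<^esup>" and "E \<noteq> {}"
    using assms(1) by (simp_all add: simple_graph_def)
  have fE: "finite E" using EV finite_imp_finite_nsets[OF fV] finite_subset by blast
  have "\<exists>k C. edge_id_code E C \<and> card C = k" using pendant_free_imp_code[OF EV assms(2)] by blast
  then obtain C where C: "edge_id_code E C" "card C = gamma_EID E"
    using LeastI_ex[of "\<lambda>k. \<exists>C. edge_id_code E C \<and> card C = k"] unfolding gamma_EID_def by blast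
  have fC: "finite C" using C(1) fE finite_subset by (auto simp: edge_id_code_def)
  interpret irredundant_code V E C
  proof
    fix c assume "c \<in> C"
    show "\<not> edge_id_code E (C - {c})"
    proof
      assume "edge_id_code E (C - {c})"
      hence "gamma_EID E \<le> card (C - {c})" unfolding gamma_EID_def by (intro Least_le) blast
      also have "\<dots> < card C" using fC \<open>c \<in> C\<close> by (rule card_Diff1_less)
      finally show False using C(2) by simp
    qed
  qed (use fV EV C(1) in auto)
  obtain e where e: "e \<in> E" using \<open>E \<noteq> {}\<close> by auto
  hence "e \<in> [V]\<^bsup>2\<^esup>" using EV by blast
  hence eV: "e \<subseteq> V" "card e = 2" by (auto simp: nsets_def)
  have "card V \<ge> 2" using card_mono[OF fV eV(1)] eV(2) by simp
  moreover have "card V \<noteq> 2"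
  proof
    assume V2: "card V = 2"
    have "[V]\<^bsup>2\<^esup> \<subseteq> {V}" using card_subset_eq[OF fV] V2 by (auto simp: nsets_def)
    hence "E = [V]\<^bsup>2\<^esup>" using EV e by blast
    thus False using assms(5) is_complete_nsets[OF fV] V2 by simp
  qed
  ultimately consider "card V = 3" | "card V = 4" | "card V \<ge> 5" by linarith
  thus ?thesis
  proof cases
    case 1
    thus ?thesis using card_le_1_if_order_3 C(2) by simp
  next
    case 2
    thus ?thesis using card_le_3_if_order_4[OF _ assms(2-4)] C(2) by simp
  next
    case 3
    thus ?thesis using card_le_if_order_ge_5 C(2) by simp
  qed
qed

end
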